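(* Let $G_1\subseteq G_2\subseteq\cdots$ be a strict direct sequence of complete topological groups and $G=\bigcup_{n\in\mathbb N}G_n$. If $\mathcal O_{TG}=\mathcal O_{DL}$ on $G$, then $(G,\mathcal O_{TG})$ is complete.
   Context: Topological groups are not assumed Hausdorff. A net $(x_\alpha)_{\alpha\in A}$ in a topological group $G$ is a left Cauchy net if for each identity neighbourhood $U\subseteq G$ there is $\gamma\in A$ with $x_\beta^{-1}x_\alpha\in U$ for all $\alpha,\beta\ge\gamma$. $G$ is complete if every left Cauchy net in $G$ converges. A strict direct sequence of topological groups is an ascending sequence $G_1\subseteq G_2\subseteq\cdots$ of topological groups such that each inclusion map $G_n\to G_{n+1}$ is a group homomorphism and a topological embedding. $G=\bigcup_nG_n$ carries the unique group structure making all inclusion maps $G_n\to G$ homomorphisms. $\mathcal O_{TG}$ is the finest topology making $G$ a topological group and all inclusion maps $G_n\to G$ continuous; $\mathcal O_{DL}$ is the final topology on $G$ with respect to the inclusion maps $G_n\to G$ (a set $U\subseteq G$ is in $\mathcal O_{DL}$ iff $U\cap G_n$ is open in $G_n$ for all $n$). *)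

theory Defs
  imports "HOL-Analysis.Analysis" "HOL-Algebra.Group"
begin

section \<open>Topological groups\<close>

text \<open>No separation axiom is imposed.\<close>

definition topological_group :: "('a, 'b) monoid_scheme \<Rightarrow> 'a topology \<Rightarrow> bool" where
  "topological_group G T \<longleftrightarrow>
     group G \<and> topspace T = carrier G \<and>
     continuous_map (prod_topology T T) T (\<lambda>(x, y). x \<otimes>\<^bsub>G\<^esub> y) \<and>
     continuous_map T T (\<lambda>x. inv\<^bsub>G\<^esub> x)"

definition identity_nbhd :: "('a, 'b) monoid_scheme \<Rightarrow> 'a topology \<Rightarrow> 'a set \<Rightarrow> bool" where
  "identity_nbhd G T U \<longleftrightarrow> U \<subseteq> carrier G \<and> (\<exists>V. openin T V \<and> \<one>\<^bsub>G\<^esub> \<in> V \<and> V \<subseteq> U)"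


section \<open>Nets and completeness\<close>

text \<open>A pair \<open>(\<alpha>, \<beta>) \<in> r\<close> is read as \<open>\<alpha> \<le> \<beta>\<close>.\<close>

definition directed_set :: "'i set \<Rightarrow> 'i rel \<Rightarrow> bool" where
  "directed_set A r \<longleftrightarrow>
     A \<noteq> {} \<and> preorder_on A r \<and> (\<forall>\<alpha>\<in>A. \<forall>\<beta>\<in>A. \<exists>\<gamma>\<in>A. (\<alpha>, \<gamma>) \<in> r \<and> (\<beta>, \<gamma>) \<in> r)"

definition left_cauchy_net ::
  "('a, 'b) monoid_scheme \<Rightarrow> 'a topology \<Rightarrow> 'i set \<Rightarrow> 'i rel \<Rightarrow> ('i \<Rightarrow> 'a) \<Rightarrow> bool" where
  "left_cauchy_net G T A r x \<longleftrightarrow>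
     directed_set A r \<and> x ` A \<subseteq> carrier G \<and>
     (\<forall>U. identity_nbhd G T U \<longrightarrow>
        (\<exists>\<gamma>\<in>A. \<forall>\<alpha>\<in>A. \<forall>\<beta>\<in>A. (\<gamma>, \<alpha>) \<in> r \<longrightarrow> (\<gamma>, \<beta>) \<in> r \<longrightarrow> inv\<^bsub>G\<^esub> (x \<beta>) \<otimes>\<^bsub>G\<^esub> x \<alpha> \<in> U))"

definition net_converges_to ::
  "'a topology \<Rightarrow> 'i set \<Rightarrow> 'i rel \<Rightarrow> ('i \<Rightarrow> 'a) \<Rightarrow> 'a \<Rightarrow> bool" where
  "net_converges_to T A r x l \<longleftrightarrow>
     l \<in> topspace T \<and>
     (\<forall>U. openin T U \<longrightarrow> l \<in> U \<longrightarrow> (\<exists>\<gamma>\<in>A. \<forall>\<alpha>\<in>A. (\<gamma>, \<alpha>) \<in> r \<longrightarrow> x \<alpha> \<in> U))"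

text \<open>
  A definition cannot quantify over the type of the index sets. Here directed sets of subsets of
  the group are used; \<open>complete_group_net_converges\<close> below shows that this already gives
  convergence of the left Cauchy nets over directed sets of arbitrary type.
\<close>

definition complete_group :: "('a, 'b) monoid_scheme \<Rightarrow> 'a topology \<Rightarrow> bool" where
  "complete_group G T \<longleftrightarrow>
     (\<forall>(A :: 'a set set) r x. left_cauchy_net G T A r x \<longrightarrow> (\<exists>l. net_converges_to T A r x l))"

lemma topological_group_prod_nbhd:
  assumes "topological_group G T" "openin T W" "a \<in> carrier G" "b \<in> carrier G" "a \<otimes>\<^bsub>G\<^esub> b \<in> W"
  obtains U V where "openin T U" "openin T V" "a \<in> U" "b \<in> V"
    "\<And>u v. u \<in> U \<Longrightarrow> v \<in> V \<Longrightarrow> u \<otimes>\<^bsub>G\<^esub> v \<in> W"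
proof -
  have c: "continuous_map (prod_topology T T) T (\<lambda>(x, y). x \<otimes>\<^bsub>G\<^esub> y)" and t: "topspace T = carrier G"
    using assms(1) by (auto simp: topological_group_def)
  define P where "P = {p \<in> topspace (prod_topology T T). (\<lambda>(x, y). x \<otimes>\<^bsub>G\<^esub> y) p \<in> W}"
  have "openin (prod_topology T T) P"
    unfolding P_def by (rule openin_continuous_map_preimage[OF c assms(2)])
  moreover have "(a, b) \<in> P"
    using assms t by (simp add: P_def)
  ultimately obtain U V where UV: "openin T U" "openin T V" "a \<in> U" "b \<in> V" "U \<times> V \<subseteq> P"
    by (force simp: openin_prod_topology_alt)
  have "u \<otimes>\<^bsub>G\<^esub> v \<in> W" if "u \<in> U" "v \<in> V" for u v
    using UV(5) that by (auto simp: P_def)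
  with UV(1-4) show ?thesis by (rule that)
qed

theorem complete_group_net_converges:
  fixes G (structure) and A :: "'i set"
  assumes tg: "topological_group G T" and "complete_group G T" and cau: "left_cauchy_net G T A r x"
  shows "\<exists>l. net_converges_to T A r x l"
proof -
  interpret group G using tg by (simp add: topological_group_def)
  have tT: "topspace T = carrier G" and ci: "continuous_map T T (\<lambda>x. inv x)"
    using tg by (auto simp: topological_group_def)
  define B where "B = {U. identity_nbhd G T U}"
  define s where "s = {(U, V). U \<in> B \<and> V \<in> B \<and> V \<subseteq> U}"
  have Ball: "carrier G \<in> B"
    using openin_topspace[of T] by (auto simp: B_def identity_nbhd_def tT)
  have Bint: "U \<inter> V \<in> B" if "U \<in> B" "V \<in> B" for U V
  proof -
    obtain U' V' where "openin T U'" "\<one> \<in> U'" "U' \<subseteq> U" "openin T V'" "\<one> \<in> V'" "V' \<subseteq> V"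
      and "U \<subseteq> carrier G"
      using \<open>U \<in> B\<close> \<open>V \<in> B\<close> by (auto simp: B_def identity_nbhd_def)
    then show ?thesis unfolding B_def identity_nbhd_def mem_Collect_eq
      by (intro conjI exI[of _ "U' \<inter> V'"]) auto
  qed
  have dirB: "directed_set B s"
    unfolding directed_set_def preorder_on_def
  proof (intro conjI ballI)
    fix U V assume "U \<in> B" "V \<in> B"
    then show "\<exists>W\<in>B. (U, W) \<in> s \<and> (V, W) \<in> s"
      using Bint[of U V] by (intro bexI[of _ "U \<inter> V"]) (auto simp: s_def)
  qed (use Ball in \<open>auto simp: s_def refl_on_def trans_def\<close>)
  have dirA: "\<exists>\<gamma>\<in>A. (\<alpha>, \<gamma>) \<in> r \<and> (\<beta>, \<gamma>) \<in> r" if "\<alpha> \<in> A" "\<beta> \<in> A" for \<alpha> \<beta>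
    using cau that by (auto simp: left_cauchy_net_def directed_set_def)
  have rr: "refl_on A r" "trans r"
    using cau by (auto simp: left_cauchy_net_def directed_set_def preorder_on_def)
  have xc: "x \<alpha> \<in> carrier G" if "\<alpha> \<in> A" for \<alpha>
    using cau that by (auto simp: left_cauchy_net_def)
  have "\<forall>U\<in>B. \<exists>\<gamma>\<in>A. \<forall>\<alpha>\<in>A. \<forall>\<beta>\<in>A. (\<gamma>, \<alpha>) \<in> r \<longrightarrow> (\<gamma>, \<beta>) \<in> r \<longrightarrow> inv (x \<beta>) \<otimes> x \<alpha> \<in> U"
    using cau by (auto simp: left_cauchy_net_def B_def)
  then obtain g where gA: "\<And>U. U \<in> B \<Longrightarrow> g U \<in> A"
    and g: "\<And>U \<alpha> \<beta>. U \<in> B \<Longrightarrow> \<alpha> \<in> A \<Longrightarrow> \<beta> \<in> A \<Longrightarrow> (g U, \<alpha>) \<in> r \<Longrightarrow> (g U, \<beta>) \<in> r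
              \<Longrightarrow> inv (x \<beta>) \<otimes> x \<alpha> \<in> U"
    by metis
  have grefl: "(g U, g U) \<in> r" if "U \<in> B" for U
    using rr gA[OF that] by (auto simp: refl_on_def)
  have "left_cauchy_net G T B s (\<lambda>U. x (g U))"
    unfolding left_cauchy_net_def
  proof (intro conjI allI impI dirB)
    show "(\<lambda>U. x (g U)) ` B \<subseteq> carrier G" using gA xc by auto
    fix W assume "identity_nbhd G T W"
    then obtain W' where W': "openin T W'" "\<one> \<in> W'" "W' \<subseteq> W" by (auto simp: identity_nbhd_def)
    then obtain P Q where PQ: "openin T P" "openin T Q" "\<one> \<in> P" "\<one> \<in> Q"
      "\<And>u v. u \<in> P \<Longrightarrow> v \<in> Q \<Longrightarrow> u \<otimes> v \<in> W'"
      using topological_group_prod_nbhd[OF tg W'(1) one_closed one_closed] by auto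
    define Q' where "Q' = {q \<in> topspace T. inv q \<in> Q}"
    have "openin T Q'" unfolding Q'_def by (rule openin_continuous_map_preimage[OF ci PQ(2)])
    then have "openin T (P \<inter> Q')" "\<one> \<in> P \<inter> Q'" using PQ by (auto simp: Q'_def tT)
    then have V: "P \<inter> Q' \<in> B"
      using openin_subset[of T "P \<inter> Q'"] by (auto simp: B_def identity_nbhd_def tT)
    show "\<exists>\<gamma>\<in>B. \<forall>\<alpha>\<in>B. \<forall>\<beta>\<in>B. (\<gamma>, \<alpha>) \<in> s \<longrightarrow> (\<gamma>, \<beta>) \<in> s \<longrightarrow> inv (x (g \<beta>)) \<otimes> x (g \<alpha>) \<in> W"
    proof (intro bexI[OF _ V] ballI impI)
      fix U1 U2 assume U: "U1 \<in> B" "U2 \<in> B" "(P \<inter> Q', U1) \<in> s" "(P \<inter> Q', U2) \<in> s"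
      obtain d where d: "d \<in> A" "(g U1, d) \<in> r" "(g U2, d) \<in> r"
        using dirA gA U by meson
      have "inv (x (g U2)) \<otimes> x d \<in> P" "inv (x (g U1)) \<otimes> x d \<in> Q'"
        using g[OF U(2) d(1) gA[OF U(2)] d(3) grefl[OF U(2)]]
          g[OF U(1) d(1) gA[OF U(1)] d(2) grefl[OF U(1)]] U by (auto simp: s_def)
      then have "(inv (x (g U2)) \<otimes> x d) \<otimes> inv (inv (x (g U1)) \<otimes> x d) \<in> W'"
        using PQ(5) by (auto simp: Q'_def)
      also have "(inv (x (g U2)) \<otimes> x d) \<otimes> inv (inv (x (g U1)) \<otimes> x d) = inv (x (g U2)) \<otimes> x (g U1)"
      proof -
        have c: "x (g U1) \<in> carrier G" "x (g U2) \<in> carrier G" "x d \<in> carrier G"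
          using xc gA U d by auto
        then have "x d \<otimes> (inv (x d) \<otimes> x (g U1)) = x (g U1)" by (simp flip: m_assoc)
        with c show ?thesis by (simp add: inv_mult_group m_assoc)
      qed
      finally show "inv (x (g U2)) \<otimes> x (g U1) \<in> W" using W' by auto
    qed
  qed
  then obtain l where l: "net_converges_to T B s (\<lambda>U. x (g U)) l"
    using assms(2) unfolding complete_group_def by blast
  have lc: "l \<in> carrier G" using l by (simp add: net_converges_to_def tT)
  have "net_converges_to T A r x l"
    unfolding net_converges_to_def
  proof (intro conjI allI impI)
    show "l \<in> topspace T" using lc tT by simp
    fix U assume U: "openin T U" "l \<in> U"
    obtain P Q where PQ: "openin T P" "openin T Q" "l \<in> P" "\<one> \<in> Q"
      "\<And>u v. u \<in> P \<Longrightarrow> v \<in> Q \<Longrightarrow> u \<otimes> v \<in> U"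
      using topological_group_prod_nbhd[OF tg U(1) lc one_closed] U lc by auto
    have QB: "Q \<in> B" using PQ openin_subset[of T Q] by (auto simp: B_def identity_nbhd_def tT)
    obtain U0 where U0: "U0 \<in> B" "\<And>V. V \<in> B \<Longrightarrow> (U0, V) \<in> s \<Longrightarrow> x (g V) \<in> P"
      using l PQ unfolding net_converges_to_def by metis
    define V where "V = U0 \<inter> Q"
    have V: "V \<in> B" "V \<subseteq> Q" "x (g V) \<in> P"
      using Bint[OF U0(1) QB] U0 by (auto simp: V_def s_def)
    show "\<exists>\<gamma>\<in>A. \<forall>\<alpha>\<in>A. (\<gamma>, \<alpha>) \<in> r \<longrightarrow> x \<alpha> \<in> U"
    proof (intro bexI[OF _ gA[OF V(1)]] ballI impI)
      fix \<alpha> assume a: "\<alpha> \<in> A" "(g V, \<alpha>) \<in> r"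
      have "inv (x (g V)) \<otimes> x \<alpha> \<in> Q"
        using g[OF V(1) a(1) gA[OF V(1)] a(2) grefl[OF V(1)]] V by auto
      then have "x (g V) \<otimes> (inv (x (g V)) \<otimes> x \<alpha>) \<in> U" using PQ V by auto
      then show "x \<alpha> \<in> U" using xc[OF a(1)] xc[OF gA[OF V(1)]] by (simp flip: m_assoc)
    qed
  qed
  then show ?thesis by blast
qed


section \<open>Strict direct sequences\<close>

definition strict_direct_sequence ::
  "(nat \<Rightarrow> ('a, 'b) monoid_scheme) \<Rightarrow> (nat \<Rightarrow> 'a topology) \<Rightarrow> bool" where
  "strict_direct_sequence G T \<longleftrightarrow>
     (\<forall>n. topological_group (G n) (T n)) \<and>
     (\<forall>n. carrier (G n) \<subseteq> carrier (G (Suc n))) \<and>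
     (\<forall>n. id \<in> hom (G n) (G (Suc n))) \<and>
     (\<forall>n. embedding_map (T n) (T (Suc n)) id)"

text \<open>
  The choice of the first common index is immaterial (\<open>union_group_mult\<close>), and this is the only
  group structure making the inclusions homomorphisms (\<open>union_group_unique\<close>).
\<close>

definition union_group :: "(nat \<Rightarrow> ('a, 'b) monoid_scheme) \<Rightarrow> 'a monoid" where
  "union_group G =
     \<lparr>carrier = (\<Union>n. carrier (G n)),
      mult = (\<lambda>x y. x \<otimes>\<^bsub>G (LEAST n. x \<in> carrier (G n) \<and> y \<in> carrier (G n))\<^esub> y),
      one = \<one>\<^bsub>G 0\<^esub>\<rparr>"

lemma strict_direct_sequence_le:
  assumes "strict_direct_sequence G T" "m \<le> n"
  shows "id \<in> hom (G m) (G n)"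
  using assms(2)
proof (induction rule: dec_induct)
  case base
  show ?case by (simp add: hom_def)
next
  case (step n)
  have "id \<in> hom (G n) (G (Suc n))" using assms(1) by (simp add: strict_direct_sequence_def)
  with step.IH show ?case by (auto simp: hom_def Pi_iff)
qed

lemma union_group_mult:
  assumes "strict_direct_sequence G T" "x \<in> carrier (G n)" "y \<in> carrier (G n)"
  shows "x \<otimes>\<^bsub>union_group G\<^esub> y = x \<otimes>\<^bsub>G n\<^esub> y"
proof -
  define k where "k = (LEAST n. x \<in> carrier (G n) \<and> y \<in> carrier (G n))"
  have "x \<in> carrier (G k) \<and> y \<in> carrier (G k)"
    unfolding k_def by (rule LeastI[of _ n]) (use assms in simp)
  moreover have "k \<le> n" unfolding k_def by (rule Least_le) (use assms in simp)
  ultimately have "x \<otimes>\<^bsub>G k\<^esub> y = x \<otimes>\<^bsub>G n\<^esub> y"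
    using strict_direct_sequence_le[OF assms(1)] by (auto simp: hom_def)
  then show ?thesis by (simp add: union_group_def k_def)
qed

lemma carrier_union_group: "carrier (union_group G) = (\<Union>n. carrier (G n))"
  by (simp add: union_group_def)

lemma union_group_inclusion_hom:
  assumes "strict_direct_sequence G T"
  shows "id \<in> hom (G n) (union_group G)"
  using union_group_mult[OF assms] by (auto simp: hom_def carrier_union_group)

lemma group_union_group:
  assumes seq: "strict_direct_sequence G T"
  shows "group (union_group G)"
proof -
  have grp: "group (G n)" for n
    using seq by (simp add: strict_direct_sequence_def topological_group_def)
  have up: "x \<in> carrier (G n)" if "x \<in> carrier (G m)" "m \<le> n" for x m n
    using strict_direct_sequence_le[OF seq that(2)] that(1) by (auto simp: hom_def)
  have one: "\<one>\<^bsub>union_group G\<^esub> = \<one>\<^bsub>G n\<^esub>" for n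
    using hom_one[OF strict_direct_sequence_le[OF seq, of 0 n] grp grp]
    by (simp add: union_group_def)
  note mu = union_group_mult[OF seq]
  show ?thesis
  proof (rule groupI; unfold carrier_union_group)
    fix x y assume "x \<in> (\<Union>n. carrier (G n))" "y \<in> (\<Union>n. carrier (G n))"
    then obtain i j where "x \<in> carrier (G i)" "y \<in> carrier (G j)" by auto
    then have "x \<in> carrier (G (max i j))" "y \<in> carrier (G (max i j))" using up by auto
    then show "x \<otimes>\<^bsub>union_group G\<^esub> y \<in> (\<Union>n. carrier (G n))"
      using mu monoid.m_closed[OF group.is_monoid[OF grp], of x "max i j" y] by auto
  next
    show "\<one>\<^bsub>union_group G\<^esub> \<in> (\<Union>n. carrier (G n))"
      using one[of 0] monoid.one_closed[OF group.is_monoid[OF grp, of 0]] by auto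
  next
    fix x y z
    assume "x \<in> (\<Union>n. carrier (G n))" "y \<in> (\<Union>n. carrier (G n))" "z \<in> (\<Union>n. carrier (G n))"
    then obtain i j k where "x \<in> carrier (G i)" "y \<in> carrier (G j)" "z \<in> carrier (G k)" by auto
    define n where "n = max i (max j k)"
    interpret n: group "G n" by (rule grp)
    have "x \<in> carrier (G n)" "y \<in> carrier (G n)" "z \<in> carrier (G n)"
      using \<open>x \<in> carrier (G i)\<close> \<open>y \<in> carrier (G j)\<close> \<open>z \<in> carrier (G k)\<close> up by (auto simp: n_def)
    then show "x \<otimes>\<^bsub>union_group G\<^esub> y \<otimes>\<^bsub>union_group G\<^esub> z = x \<otimes>\<^bsub>union_group G\<^esub> (y \<otimes>\<^bsub>union_group G\<^esub> z)"
      by (simp add: mu[where n=n] n.m_assoc)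
  next
    fix x assume "x \<in> (\<Union>n. carrier (G n))"
    then obtain n where x: "x \<in> carrier (G n)" by auto
    interpret n: group "G n" by (rule grp)
    show "\<one>\<^bsub>union_group G\<^esub> \<otimes>\<^bsub>union_group G\<^esub> x = x"
      using x by (simp add: one[of n] mu[where n=n])
    show "\<exists>y\<in>\<Union>n. carrier (G n). y \<otimes>\<^bsub>union_group G\<^esub> x = \<one>\<^bsub>union_group G\<^esub>"
      using x by (intro bexI[of _ "inv\<^bsub>G n\<^esub> x"]) (auto simp: one[of n] mu[where n=n])
  qed
qed

lemma union_group_unique:
  assumes seq: "strict_direct_sequence G T"
    and "group H" "carrier H = (\<Union>n. carrier (G n))" "\<And>n. id \<in> hom (G n) H"
  shows "id \<in> iso H (union_group G)"
proof -
  have "x \<otimes>\<^bsub>H\<^esub> y = x \<otimes>\<^bsub>union_group G\<^esub> y" if xy: "x \<in> carrier H" "y \<in> carrier H" for x y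
  proof -
    obtain i j where "x \<in> carrier (G i)" "y \<in> carrier (G j)" using xy assms(3) by auto
    then have "x \<in> carrier (G (max i j))" "y \<in> carrier (G (max i j))"
      using strict_direct_sequence_le[OF seq, of i "max i j"]
        strict_direct_sequence_le[OF seq, of j "max i j"]
      by (auto simp: hom_def)
    then show ?thesis
      using union_group_mult[OF seq, of x "max i j" y] assms(4)[of "max i j"] by (auto simp: hom_def)
  qed
  then show ?thesis
    using monoid.m_closed[OF group.is_monoid[OF group_union_group[OF seq]]] assms(3)
    by (auto simp: iso_def hom_def carrier_union_group)
qed


section \<open>The topologies on the union\<close>

definition compatible_group_topology ::
  "(nat \<Rightarrow> ('a, 'b) monoid_scheme) \<Rightarrow> (nat \<Rightarrow> 'a topology) \<Rightarrow> 'a topology \<Rightarrow> bool" where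
  "compatible_group_topology G T S \<longleftrightarrow>
     topological_group (union_group G) S \<and> (\<forall>n. continuous_map (T n) S id)"

definition finest_compatible_group_topology ::
  "(nat \<Rightarrow> ('a, 'b) monoid_scheme) \<Rightarrow> (nat \<Rightarrow> 'a topology) \<Rightarrow> 'a topology \<Rightarrow> bool" where
  "finest_compatible_group_topology G T S \<longleftrightarrow>
     compatible_group_topology G T S \<and>
     (\<forall>S'. compatible_group_topology G T S' \<longrightarrow> (\<forall>U. openin S' U \<longrightarrow> openin S U))"

text \<open>Existence of the topology denoted here is \<open>finest_compatible_group_topology_O_TG\<close>.\<close>

definition O_TG :: "(nat \<Rightarrow> ('a, 'b) monoid_scheme) \<Rightarrow> (nat \<Rightarrow> 'a topology) \<Rightarrow> 'a topology" where
  "O_TG G T = (THE S. finest_compatible_group_topology G T S)"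

definition O_DL :: "(nat \<Rightarrow> ('a, 'b) monoid_scheme) \<Rightarrow> (nat \<Rightarrow> 'a topology) \<Rightarrow> 'a topology" where
  "O_DL G T =
     topology (\<lambda>U. U \<subseteq> carrier (union_group G) \<and> (\<forall>n. openin (T n) (U \<inter> carrier (G n))))"

lemma openin_O_DL:
  "openin (O_DL G T) U \<longleftrightarrow>
     U \<subseteq> carrier (union_group G) \<and> (\<forall>n. openin (T n) (U \<inter> carrier (G n)))"
proof -
  have "istopology (\<lambda>U. U \<subseteq> carrier (union_group G) \<and> (\<forall>n. openin (T n) (U \<inter> carrier (G n))))"
    unfolding istopology_def
  proof (intro conjI allI impI)
    fix U V n
    assume a: "U \<subseteq> carrier (union_group G) \<and> (\<forall>n. openin (T n) (U \<inter> carrier (G n)))"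
      "V \<subseteq> carrier (union_group G) \<and> (\<forall>n. openin (T n) (V \<inter> carrier (G n)))"
    show "U \<inter> V \<subseteq> carrier (union_group G)" using a by auto
    have "U \<inter> V \<inter> carrier (G n) = (U \<inter> carrier (G n)) \<inter> (V \<inter> carrier (G n))" by auto
    then show "openin (T n) (U \<inter> V \<inter> carrier (G n))" using a by auto
  next
    fix K n
    assume a: "\<forall>U\<in>K. U \<subseteq> carrier (union_group G) \<and> (\<forall>n. openin (T n) (U \<inter> carrier (G n)))"
    show "\<Union>K \<subseteq> carrier (union_group G)" using a by auto
    have "\<Union>K \<inter> carrier (G n) = \<Union>((\<lambda>U. U \<inter> carrier (G n)) ` K)" by auto
    moreover have "openin (T n) (\<Union>((\<lambda>U. U \<inter> carrier (G n)) ` K))"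
      by (rule openin_Union) (use a in auto)
    ultimately show "openin (T n) (\<Union>K \<inter> carrier (G n))" by metis
  qed
  then show ?thesis unfolding O_DL_def by (simp add: topology_inverse')
qed

lemma ex_finest_compatible_group_topology:
  assumes seq: "strict_direct_sequence G T"
  shows "\<exists>S. finest_compatible_group_topology G T S"
proof -
  let ?H = "union_group G"
  interpret H: group ?H by (rule group_union_group[OF seq])
  define F where "F = {U. \<exists>S. compatible_group_topology G T S \<and> openin S U}"
  define S0 where "S0 = topology_generated_by F"
  define I where "I = topology_generated_by {carrier ?H}"
  have tT: "topspace (T n) = carrier (G n)" for n
    using seq by (auto simp: strict_direct_sequence_def topological_group_def)
  have tI: "topspace I = carrier ?H" by (simp add: I_def)
  have "compatible_group_topology G T I"
    unfolding compatible_group_topology_def topological_group_def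
  proof (intro conjI allI tI H.is_group)
    have all: "continuous_map X I f" if "f ` topspace X \<subseteq> carrier ?H" for X :: "'c topology" and f
    proof -
      have "f -` carrier ?H \<inter> topspace X = topspace X" using that by auto
      then show ?thesis unfolding I_def continuous_on_generated_topo_iff using that by auto
    qed
    show "continuous_map (prod_topology I I) I (\<lambda>(x, y). x \<otimes>\<^bsub>?H\<^esub> y)"
      by (rule all) (auto simp: tI)
    show "continuous_map I I (\<lambda>x. inv\<^bsub>?H\<^esub> x)" by (rule all) (auto simp: tI)
    show "continuous_map (T n) I id" for n by (rule all) (auto simp: tT carrier_union_group)
  qed
  then have "carrier ?H \<in> F" unfolding F_def using tI openin_topspace[of I] by auto
  moreover have "U \<subseteq> carrier ?H" if "U \<in> F" for U
    using that openin_subset unfolding F_def compatible_group_topology_def topological_group_def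
    by blast
  ultimately have UF: "\<Union>F = carrier ?H" by auto
  have tS0: "topspace S0 = carrier ?H" by (simp add: S0_def UF)
  have finer: "openin S0 U" if "compatible_group_topology G T S" "openin S U" for S U
    unfolding S0_def using that by (intro topology_generated_by_Basis) (auto simp: F_def)
  have idc: "continuous_map S0 S id" if "compatible_group_topology G T S" for S
  proof -
    have tS: "topspace S = carrier ?H"
      using that by (simp add: compatible_group_topology_def topological_group_def)
    have "{x \<in> carrier ?H. x \<in> U} = U" if "openin S U" for U
      using openin_subset[OF that] tS by auto
    then show ?thesis using finer[OF that] by (auto simp: continuous_map_def tS tS0)
  qed
  have "compatible_group_topology G T S0"
    unfolding compatible_group_topology_def topological_group_def
  proof (intro conjI allI tS0 H.is_group)
    have gen: "continuous_map X S0 f"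
      if "\<And>S. compatible_group_topology G T S \<Longrightarrow> continuous_map X S f" "f ` topspace X \<subseteq> carrier ?H"
      for X :: "'c topology" and f
      unfolding S0_def continuous_on_generated_topo_iff UF
    proof (intro conjI allI impI that(2))
      fix U assume "U \<in> F"
      then obtain S where S: "compatible_group_topology G T S" "openin S U" by (auto simp: F_def)
      have "f -` U \<inter> topspace X = {x \<in> topspace X. f x \<in> U}" by auto
      then show "openin X (f -` U \<inter> topspace X)"
        using openin_continuous_map_preimage[OF that(1)[OF S(1)] S(2)] by simp
    qed
    show "continuous_map (prod_topology S0 S0) S0 (\<lambda>(x, y). x \<otimes>\<^bsub>?H\<^esub> y)"
    proof (rule gen)
      fix S assume S: "compatible_group_topology G T S"
      have "continuous_map (prod_topology S0 S0) (prod_topology S S) id"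
        using idc[OF S] continuous_map_prod_top[of S0 S0 S S id id] by (simp add: id_def case_prod_unfold)
      moreover have "continuous_map (prod_topology S S) S (\<lambda>(x, y). x \<otimes>\<^bsub>?H\<^esub> y)"
        using S by (simp add: compatible_group_topology_def topological_group_def)
      ultimately show "continuous_map (prod_topology S0 S0) S (\<lambda>(x, y). x \<otimes>\<^bsub>?H\<^esub> y)"
        using continuous_map_compose by fastforce
    qed (auto simp: tS0)
    show "continuous_map S0 S0 (\<lambda>x. inv\<^bsub>?H\<^esub> x)"
    proof (rule gen)
      fix S assume S: "compatible_group_topology G T S"
      then have "continuous_map S S (\<lambda>x. inv\<^bsub>?H\<^esub> x)"
        by (simp add: compatible_group_topology_def topological_group_def)
      then show "continuous_map S0 S (\<lambda>x. inv\<^bsub>?H\<^esub> x)"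
        using continuous_map_compose[OF idc[OF S]] by fastforce
    qed (auto simp: tS0)
    show "continuous_map (T n) S0 id" for n
      by (rule gen) (auto simp: compatible_group_topology_def tT carrier_union_group)
  qed
  then have "finest_compatible_group_topology G T S0"
    by (simp add: finest_compatible_group_topology_def finer)
  then show ?thesis by (rule exI)
qed

lemma finest_compatible_group_topology_O_TG:
  assumes "strict_direct_sequence G T"
  shows "finest_compatible_group_topology G T (O_TG G T)"
proof -
  have "S = S'" if "finest_compatible_group_topology G T S" "finest_compatible_group_topology G T S'"
    for S S'
    using that unfolding finest_compatible_group_topology_def topology_eq by blast
  then have "\<exists>!S. finest_compatible_group_topology G T S"
    using ex_finest_compatible_group_topology[OF assms] by blast
  then show ?thesis unfolding O_TG_def by (rule theI')
qed

end

(*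
  Let (x_a) be a left Cauchy net in G. If every G_n had an identity neighbourhood U_n such that
  the net eventually avoids G_n U_n, then the intersection of the sets G_n U_n would be a neighbourhood
  of the identity: it meets G_m in the intersection of the finitely many open sets G_n U_n with
  n < m, so it is open in the direct limit topology. Applying the Cauchy condition to it gives a
  contradiction. Hence for some n the net is frequently in G_n U for every identity neighbourhood U.
  Approximating it there by elements of G_n gives a left Cauchy net in G_n, as G_n is embedded
  in G, and the limit of this net in G_n is a limit of (x_a).
*)

theory Submission
  imports Defs
begin

section \<open>Open sets in topological groups\<close>

text \<open>The set is the product K U. If h lies in g U, then continuity of multiplication at the
  pair (inverse of g, h) gives a neighbourhood of h on which the same g works.\<close>

lemma openin_translates_union:
  assumes tg: "topological_group G T" and U: "openin T U" and K: "K \<subseteq> carrier G"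
  shows "openin T {h \<in> carrier G. \<exists>g\<in>K. inv\<^bsub>G\<^esub> g \<otimes>\<^bsub>G\<^esub> h \<in> U}"
proof (subst openin_subopen, intro ballI)
  interpret group G using tg by (simp add: topological_group_def)
  have tT: "topspace T = carrier G" using tg by (simp add: topological_group_def)
  fix h assume "h \<in> {h \<in> carrier G. \<exists>g\<in>K. inv\<^bsub>G\<^esub> g \<otimes>\<^bsub>G\<^esub> h \<in> U}"
  then obtain g where g: "h \<in> carrier G" "g \<in> K" "inv\<^bsub>G\<^esub> g \<otimes>\<^bsub>G\<^esub> h \<in> U" by auto
  then have "inv\<^bsub>G\<^esub> g \<in> carrier G" using K by auto
  then obtain P Q where PQ: "openin T P" "openin T Q" "inv\<^bsub>G\<^esub> g \<in> P" "h \<in> Q"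
    "\<And>u v. u \<in> P \<Longrightarrow> v \<in> Q \<Longrightarrow> u \<otimes>\<^bsub>G\<^esub> v \<in> U"
    using topological_group_prod_nbhd[OF tg U _ g(1) g(3)] by blast
  have "Q \<subseteq> {h \<in> carrier G. \<exists>g\<in>K. inv\<^bsub>G\<^esub> g \<otimes>\<^bsub>G\<^esub> h \<in> U}"
    using PQ g(2) openin_subset[OF PQ(2)] tT by blast
  with PQ show "\<exists>S. openin T S \<and> h \<in> S \<and> S \<subseteq> {h \<in> carrier G. \<exists>g\<in>K. inv\<^bsub>G\<^esub> g \<otimes>\<^bsub>G\<^esub> h \<in> U}"
    by blast
qed

text \<open>The shape fits the Cauchy estimate for approximants in a stage: their quotient is a
  product of two small elements and the inverse of a third.\<close>

lemma topological_group_mult_mult_inv_nbhd: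
  assumes tg: "topological_group G T" and W: "openin T W" "\<one>\<^bsub>G\<^esub> \<in> W"
  obtains V where "openin T V" "\<one>\<^bsub>G\<^esub> \<in> V"
    "\<And>u v w. u \<in> V \<Longrightarrow> v \<in> V \<Longrightarrow> w \<in> V \<Longrightarrow> u \<otimes>\<^bsub>G\<^esub> v \<otimes>\<^bsub>G\<^esub> inv\<^bsub>G\<^esub> w \<in> W"
proof -
  interpret group G using tg by (simp add: topological_group_def)
  have ci: "continuous_map T T (\<lambda>x. inv\<^bsub>G\<^esub> x)" and tT: "topspace T = carrier G"
    using tg by (auto simp: topological_group_def)
  obtain P Q where PQ: "openin T P" "openin T Q" "\<one>\<^bsub>G\<^esub> \<in> P" "\<one>\<^bsub>G\<^esub> \<in> Q"
    "\<And>u v. u \<in> P \<Longrightarrow> v \<in> Q \<Longrightarrow> u \<otimes>\<^bsub>G\<^esub> v \<in> W"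
    using topological_group_prod_nbhd[OF tg W(1) one_closed one_closed] W by auto
  obtain R S where RS: "openin T R" "openin T S" "\<one>\<^bsub>G\<^esub> \<in> R" "\<one>\<^bsub>G\<^esub> \<in> S"
    "\<And>u v. u \<in> R \<Longrightarrow> v \<in> S \<Longrightarrow> u \<otimes>\<^bsub>G\<^esub> v \<in> P"
    using topological_group_prod_nbhd[OF tg PQ(1) one_closed one_closed] PQ by auto
  define Q' where "Q' = {q \<in> topspace T. inv\<^bsub>G\<^esub> q \<in> Q}"
  have "openin T Q'" unfolding Q'_def by (rule openin_continuous_map_preimage[OF ci PQ(2)])
  then have "openin T (R \<inter> S \<inter> Q')" "\<one>\<^bsub>G\<^esub> \<in> R \<inter> S \<inter> Q'"
    using RS PQ by (auto simp: Q'_def tT)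
  then show ?thesis by (rule that) (auto simp: Q'_def intro: PQ RS)
qed

section \<open>Stages as subgroups of the direct limit\<close>

lemma strict_direct_sequence_carrier_mono:
  assumes "strict_direct_sequence G T" "m \<le> n"
  shows "carrier (G m) \<subseteq> carrier (G n)"
  using strict_direct_sequence_le[OF assms] by (auto simp: hom_def)

lemma strict_direct_sequence_subtopology:
  assumes seq: "strict_direct_sequence G T" and "m \<le> n"
  shows "T m = subtopology (T n) (carrier (G m))"
  using assms(2)
proof (induction rule: dec_induct)
  case base
  have "topspace (T m) = carrier (G m)"
    using seq by (simp add: strict_direct_sequence_def topological_group_def)
  then show ?case by (metis subtopology_topspace)
next
  case (step n)
  have "embedding_map (T n) (T (Suc n)) id" and t: "topspace (T n) = carrier (G n)"
    using seq by (auto simp: strict_direct_sequence_def topological_group_def)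
  \<comment> \<open>A homeomorphism onto the image whose underlying map is \<open>id\<close> forces
    the two topologies to coincide.\<close>
  then have "T n = subtopology (T (Suc n)) (carrier (G n))"
    by (simp add: embedding_map_def)
  then have "T m = subtopology (T (Suc n)) (carrier (G n) \<inter> carrier (G m))"
    using step.IH by (metis subtopology_subtopology)
  moreover have "carrier (G n) \<inter> carrier (G m) = carrier (G m)"
    using strict_direct_sequence_carrier_mono[OF seq step.hyps(1)] by auto
  ultimately show ?case by simp
qed

text \<open>Traces of \<open>O_DL\<close>-open sets on a stage are open by the definition of
  \<open>O_DL\<close>; with this converse each stage carries the subspace topology. It serves to
  extend identity neighbourhoods of G_n to the union.\<close>

lemma openin_O_DL_extension:
  assumes seq: "strict_direct_sequence G T" and U: "openin (T n) U"
  obtains W where "openin (O_DL G T) W" "W \<inter> carrier (G n) = U"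
proof -
  note sub = strict_direct_sequence_subtopology[OF seq]
  note mono = strict_direct_sequence_carrier_mono[OF seq]
  have tT: "topspace (T k) = carrier (G k)" for k
    using seq by (simp add: strict_direct_sequence_def topological_group_def)
  \<comment> \<open>Taking the largest admissible open set at each stage replaces a recursive choice
    of extensions: maximality alone makes the sets for k \<ge> n traces of one another.\<close>
  define V where "V k = \<Union>{V. openin (T k) V \<and> V \<inter> carrier (G n) \<subseteq> U}" for k
  have Vo: "openin (T k) (V k)" for k unfolding V_def by auto
  have trace: "V j \<inter> carrier (G k) = V k" if k: "n \<le> k" "k \<le> j" for j k
  proof
    have "openin (T k) (V j \<inter> carrier (G k))"
      using Vo[of j] sub[OF k(2)] by (auto simp: openin_subtopology)
    then show "V j \<inter> carrier (G k) \<subseteq> V k" by (auto simp: V_def)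
    obtain V' where V': "openin (T j) V'" "V' \<inter> carrier (G k) = V k"
      using Vo[of k] sub[OF k(2)] by (auto simp: openin_subtopology)
    then have "V' \<inter> carrier (G n) \<subseteq> U" using mono[OF k(1)] by (auto simp: V_def)
    with V' show "V k \<subseteq> V j \<inter> carrier (G k)" by (auto simp: V_def)
  qed
  define W where "W = (\<Union>k\<in>{n..}. V k)"
  have WV: "W \<inter> carrier (G k) = V k" if "n \<le> k" for k
  proof
    show "W \<inter> carrier (G k) \<subseteq> V k"
    proof
      fix z assume "z \<in> W \<inter> carrier (G k)"
      then obtain j where j: "n \<le> j" "z \<in> V j" "z \<in> carrier (G k)" by (auto simp: W_def)
      show "z \<in> V k"
      proof (cases "j \<le> k")
        case True then show ?thesis using trace[OF j(1) True] j by auto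
      next
        case False then show ?thesis using trace[OF that, of j] j by auto
      qed
    qed
    show "V k \<subseteq> W \<inter> carrier (G k)"
      using that openin_subset[OF Vo[of k]] tT by (auto simp: W_def)
  qed
  have "openin (T m) (W \<inter> carrier (G m))" for m
  proof -
    \<comment> \<open>\<open>WV\<close> covers only stages from n on, so an earlier stage is reached
      through stage n.\<close>
    have "W \<inter> carrier (G m) = V (max m n) \<inter> carrier (G m)"
      using WV[of "max m n"] mono[of m "max m n"] by auto
    then show ?thesis using Vo[of "max m n"] sub[of m "max m n"] by (auto simp: openin_subtopology)
  qed
  moreover have "W \<subseteq> carrier (union_group G)"
    using openin_subset[OF Vo] tT by (fastforce simp: W_def carrier_union_group)
  ultimately have "openin (O_DL G T) W" by (simp add: openin_O_DL)
  moreover have "V n = U"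
  proof
    have "V \<subseteq> U" if "openin (T n) V" "V \<inter> carrier (G n) \<subseteq> U" for V
      using that openin_subset[OF that(1)] tT by auto
    then show "V n \<subseteq> U" by (auto simp: V_def)
    show "U \<subseteq> V n" using U by (auto simp: V_def)
  qed
  ultimately show ?thesis using WV[of n] that by simp
qed

lemma strict_direct_sequence_inv_mult:
  assumes seq: "strict_direct_sequence G T" and xy: "x \<in> carrier (G n)" "y \<in> carrier (G n)"
  shows "inv\<^bsub>G n\<^esub> x \<otimes>\<^bsub>G n\<^esub> y = inv\<^bsub>union_group G\<^esub> x \<otimes>\<^bsub>union_group G\<^esub> y"
proof -
  have g: "group (G n)"
    using seq by (simp add: strict_direct_sequence_def topological_group_def)
  interpret group_hom "G n" "union_group G" id
    using g group_union_group[OF seq] union_group_inclusion_hom[OF seq]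
    by (simp add: group_hom_def group_hom_axioms_def)
  have "inv\<^bsub>G n\<^esub> x \<in> carrier (G n)" using group.inv_closed[OF g] xy by auto
  then have "inv\<^bsub>union_group G\<^esub> x \<in> carrier (G n)" using hom_inv[OF xy(1)] by simp
  then show ?thesis
    using hom_inv[OF xy(1)] union_group_mult[OF seq, of "inv\<^bsub>union_group G\<^esub> x" n y] xy by simp
qed

section \<open>A Cauchy net is frequently close to one stage\<close>

text \<open>The condition on \<open>x \<beta>\<close> is membership in G_n U. The point is the order
  of quantifiers: n is fixed before U and \<alpha>, so approximants of every precision lie in the
  same complete group.\<close>

lemma left_cauchy_net_frequently_near_stage:
  assumes seq: "strict_direct_sequence G T"
    and tg: "topological_group (union_group G) (O_DL G T)"
    and cau: "left_cauchy_net (union_group G) (O_DL G T) A r x"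
  obtains n where "\<And>U \<alpha>. openin (O_DL G T) U \<Longrightarrow> \<one>\<^bsub>union_group G\<^esub> \<in> U \<Longrightarrow> \<alpha> \<in> A \<Longrightarrow>
    \<exists>\<beta>\<in>A. (\<alpha>, \<beta>) \<in> r \<and> (\<exists>g\<in>carrier (G n). inv\<^bsub>union_group G\<^esub> g \<otimes>\<^bsub>union_group G\<^esub> x \<beta> \<in> U)"
proof (rule ccontr)
  let ?H = "union_group G" and ?O = "O_DL G T"
  interpret H: group ?H by (rule group_union_group[OF seq])
  assume "\<not> thesis"
  then have "\<forall>n. \<exists>U \<alpha>. openin ?O U \<and> \<one>\<^bsub>?H\<^esub> \<in> U \<and> \<alpha> \<in> A \<and>
    \<not> (\<exists>\<beta>\<in>A. (\<alpha>, \<beta>) \<in> r \<and> (\<exists>g\<in>carrier (G n). inv\<^bsub>?H\<^esub> g \<otimes>\<^bsub>?H\<^esub> x \<beta> \<in> U))"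
    using that by meson
  then obtain U a where U: "\<And>n. openin ?O (U n)" "\<And>n. \<one>\<^bsub>?H\<^esub> \<in> U n" and a: "\<And>n. a n \<in> A"
    and far: "\<And>n \<beta> g. \<beta> \<in> A \<Longrightarrow> (a n, \<beta>) \<in> r \<Longrightarrow> g \<in> carrier (G n) \<Longrightarrow>
        inv\<^bsub>?H\<^esub> g \<otimes>\<^bsub>?H\<^esub> x \<beta> \<notin> U n"
    by metis
  \<comment> \<open>This is G_n U_n, which the net avoids from \<open>a n\<close> on.\<close>
  define P where "P n = {h \<in> carrier ?H. \<exists>g\<in>carrier (G n). inv\<^bsub>?H\<^esub> g \<otimes>\<^bsub>?H\<^esub> h \<in> U n}" for n
  have cn: "carrier (G n) \<subseteq> carrier ?H" for n by (auto simp: carrier_union_group)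
  have Po: "openin ?O (P n)" for n
    unfolding P_def using openin_translates_union[OF tg U(1) cn] .
  have GP: "carrier (G n) \<subseteq> P n" for n
    using U(2)[of n] cn[of n] by (force simp: P_def)
  have one: "\<one>\<^bsub>?H\<^esub> \<in> carrier (G n)" for n
    using hom_one[OF union_group_inclusion_hom[OF seq] _ H.is_group, of n] seq
      monoid.one_closed[OF group.is_monoid, of "G n"]
    by (auto simp: strict_direct_sequence_def topological_group_def)
  define W where "W = (\<Inter>n. P n)"
  have "openin (T m) (W \<inter> carrier (G m))" for m
  proof -
    have tm: "topspace (T m) = carrier (G m)"
      using seq by (simp add: strict_direct_sequence_def topological_group_def)
    have "carrier (G m) \<subseteq> P n" if "m \<le> n" for n
      using GP strict_direct_sequence_carrier_mono[OF seq that] by blast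
    \<comment> \<open>For n \<ge> m the set \<open>P n\<close> contains all of G_m, so only finitely
      many sets cut down the trace on G_m.\<close>
    then have "W \<inter> carrier (G m) = \<Inter>((\<lambda>n. P n \<inter> carrier (G m)) ` {..m})"
      by (auto simp: W_def) (metis atMost_iff nle_le subsetD)
    moreover have "openin (T m) (\<Inter>((\<lambda>n. P n \<inter> carrier (G m)) ` {..m}))"
      by (rule openin_Inter) (use Po in \<open>auto simp: openin_O_DL\<close>)
    ultimately show ?thesis by simp
  qed
  moreover have "W \<subseteq> carrier ?H" by (auto simp: W_def P_def)
  ultimately have "openin ?O W" by (simp add: openin_O_DL)
  moreover have "\<one>\<^bsub>?H\<^esub> \<in> W" using one GP by (auto simp: W_def)
  ultimately have "identity_nbhd ?H ?O W" using \<open>W \<subseteq> carrier ?H\<close> by (auto simp: identity_nbhd_def)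
  then obtain c where c: "c \<in> A"
    and cW: "\<And>\<alpha> \<beta>. \<alpha> \<in> A \<Longrightarrow> \<beta> \<in> A \<Longrightarrow> (c, \<alpha>) \<in> r \<Longrightarrow> (c, \<beta>) \<in> r \<Longrightarrow> inv\<^bsub>?H\<^esub> (x \<beta>) \<otimes>\<^bsub>?H\<^esub> x \<alpha> \<in> W"
    using cau by (auto simp: left_cauchy_net_def)
  have xc: "x \<alpha> \<in> carrier ?H" if "\<alpha> \<in> A" for \<alpha> using cau that by (auto simp: left_cauchy_net_def)
  \<comment> \<open>The stage can be picked only now, since c depends on \<open>W\<close> and so on
    all the U_n. It must contain \<open>x c\<close>, while d below lies beyond both c and
    \<open>a n\<close>.\<close>
  obtain n where n: "x c \<in> carrier (G n)" using xc[OF c] by (auto simp: carrier_union_group)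
  obtain d where d: "d \<in> A" "(c, d) \<in> r" "(a n, d) \<in> r"
    using cau c a[of n] unfolding left_cauchy_net_def directed_set_def by meson
  have "(c, c) \<in> r"
    using cau c by (auto simp: left_cauchy_net_def directed_set_def preorder_on_def refl_on_def)
  then have "inv\<^bsub>?H\<^esub> (x c) \<otimes>\<^bsub>?H\<^esub> x d \<in> P n" using cW[OF d(1) c d(2)] by (auto simp: W_def)
  then obtain g where g: "g \<in> carrier (G n)" "inv\<^bsub>?H\<^esub> g \<otimes>\<^bsub>?H\<^esub> (inv\<^bsub>?H\<^esub> (x c) \<otimes>\<^bsub>?H\<^esub> x d) \<in> U n"
    by (auto simp: P_def)
  \<comment> \<open>Left translation by \<open>x c\<close>, an element of G_n, preserves G_n U_n;
    hence \<open>x d\<close> itself lies in G_n U_n.\<close>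
  have "x c \<otimes>\<^bsub>?H\<^esub> g \<in> carrier (G n)"
    using union_group_mult[OF seq n g(1)] n g(1) seq
    by (auto simp: strict_direct_sequence_def topological_group_def
        intro!: monoid.m_closed[OF group.is_monoid])
  moreover have "inv\<^bsub>?H\<^esub> (x c \<otimes>\<^bsub>?H\<^esub> g) \<otimes>\<^bsub>?H\<^esub> x d = inv\<^bsub>?H\<^esub> g \<otimes>\<^bsub>?H\<^esub> (inv\<^bsub>?H\<^esub> (x c) \<otimes>\<^bsub>?H\<^esub> x d)"
    using xc[OF c] xc[OF d(1)] g(1) cn[of n] by (auto simp: H.inv_mult_group H.m_assoc)
  ultimately show False using far[OF d(1) d(3)] g(2) by metis
qed

section \<open>Approximation inside one stage and convergence\<close>

theorem mainTheorem3:
  fixes G :: "nat \<Rightarrow> ('a, 'b) monoid_scheme" and T :: "nat \<Rightarrow> 'a topology"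
  assumes "strict_direct_sequence G T"
    and "\<And>n. complete_group (G n) (T n)"
    and "O_TG G T = O_DL G T"
  shows "complete_group (union_group G) (O_TG G T)"
  unfolding complete_group_def
proof (intro allI impI)
  note seq = assms(1)
  let ?H = "union_group G" and ?O = "O_DL G T"
  fix A :: "'a set set" and r x
  assume "left_cauchy_net ?H (O_TG G T) A r x"
  then have cau: "left_cauchy_net ?H ?O A r x" by (simp add: assms(3))
  \<comment> \<open>\<open>O_TG\<close> is a group topology by its choice, so the assumed equality
    makes \<open>O_DL\<close> one, while openness may still be tested stage by stage.\<close>
  have "compatible_group_topology G T ?O"
    using finest_compatible_group_topology_O_TG[OF seq] assms(3)
    by (simp add: finest_compatible_group_topology_def)
  then have tg: "topological_group ?H ?O" and "\<And>n. continuous_map (T n) ?O id"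
    by (auto simp: compatible_group_topology_def)
  have tO: "topspace ?O = carrier ?H" using tg by (simp add: topological_group_def)
  interpret H: group ?H by (rule group_union_group[OF seq])
  have xc: "x \<alpha> \<in> carrier ?H" if "\<alpha> \<in> A" for \<alpha> using cau that by (auto simp: left_cauchy_net_def)
  have dir: "\<exists>\<gamma>\<in>A. (\<alpha>, \<gamma>) \<in> r \<and> (\<beta>, \<gamma>) \<in> r" if "\<alpha> \<in> A" "\<beta> \<in> A" for \<alpha> \<beta>
    using cau that by (auto simp: left_cauchy_net_def directed_set_def)
  have pre: "preorder_on A r" and ne: "A \<noteq> {}"
    using cau by (auto simp: left_cauchy_net_def directed_set_def)
  have tr: "(\<alpha>, \<gamma>) \<in> r" if "(\<alpha>, \<beta>) \<in> r" "(\<beta>, \<gamma>) \<in> r" for \<alpha> \<beta> \<gamma>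
    using pre that by (meson preorder_on_def transD)
  have rf: "(\<alpha>, \<alpha>) \<in> r" if "\<alpha> \<in> A" for \<alpha>
    using pre that by (auto simp: preorder_on_def refl_on_def)
  have cauchy: "\<exists>\<gamma>\<in>A. \<forall>\<alpha>\<in>A. \<forall>\<beta>\<in>A. (\<gamma>, \<alpha>) \<in> r \<longrightarrow> (\<gamma>, \<beta>) \<in> r \<longrightarrow> inv\<^bsub>?H\<^esub> (x \<beta>) \<otimes>\<^bsub>?H\<^esub> x \<alpha> \<in> V"
    if "openin ?O V" "\<one>\<^bsub>?H\<^esub> \<in> V" for V
  proof -
    have "identity_nbhd ?H ?O V"
      using that openin_subset[OF that(1)] tO by (auto simp: identity_nbhd_def)
    then show ?thesis using cau by (simp add: left_cauchy_net_def)
  qed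

  obtain n where n: "\<And>U \<alpha>. openin ?O U \<Longrightarrow> \<one>\<^bsub>?H\<^esub> \<in> U \<Longrightarrow> \<alpha> \<in> A \<Longrightarrow>
      \<exists>\<beta>\<in>A. (\<alpha>, \<beta>) \<in> r \<and> (\<exists>g\<in>carrier (G n). inv\<^bsub>?H\<^esub> g \<otimes>\<^bsub>?H\<^esub> x \<beta> \<in> U)"
    using left_cauchy_net_frequently_near_stage[OF seq tg cau] by blast
  \<comment> \<open>An index pairs a precision U with a position \<alpha> in the given net;
    \<open>s\<close> refines both.\<close>
  define I where "I = {(U, \<alpha>). openin ?O U \<and> \<one>\<^bsub>?H\<^esub> \<in> U \<and> \<alpha> \<in> A}"
  define s where "s = {(i, j). i \<in> I \<and> j \<in> I \<and> fst j \<subseteq> fst i \<and> (snd i, snd j) \<in> r}"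
  \<comment> \<open>The \<beta> and g chosen here become \<open>b i\<close>, a position past
    \<alpha>, and \<open>y i\<close>, an element of G_n approximating \<open>x (b i)\<close> with
    precision U.\<close>
  have "\<forall>i\<in>I. \<exists>\<beta> g. \<beta> \<in> A \<and> (snd i, \<beta>) \<in> r \<and> g \<in> carrier (G n) \<and> inv\<^bsub>?H\<^esub> g \<otimes>\<^bsub>?H\<^esub> x \<beta> \<in> fst i"
    using n by (fastforce simp: I_def)
  then obtain b y where bA: "\<And>i. i \<in> I \<Longrightarrow> b i \<in> A" and br: "\<And>i. i \<in> I \<Longrightarrow> (snd i, b i) \<in> r"
    and yn: "\<And>i. i \<in> I \<Longrightarrow> y i \<in> carrier (G n)"
    and yx: "\<And>i. i \<in> I \<Longrightarrow> inv\<^bsub>?H\<^esub> (y i) \<otimes>\<^bsub>?H\<^esub> x (b i) \<in> fst i"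
    by metis
  have yc: "y i \<in> carrier ?H" if "i \<in> I" for i using yn[OF that] by (auto simp: carrier_union_group)
  have dirI: "directed_set I s"
    unfolding directed_set_def preorder_on_def
  proof (intro conjI ballI)
    obtain c where "c \<in> A" using ne by auto
    then have "(carrier ?H, c) \<in> I" using openin_topspace[of ?O] tO by (simp add: I_def)
    then show "I \<noteq> {}" by auto
    show "s \<subseteq> I \<times> I" by (auto simp: s_def)
    show "refl_on I s" using rf by (auto simp: refl_on_def s_def I_def)
    show "trans s" using tr by (auto simp: trans_def s_def)
    fix i j assume ij: "i \<in> I" "j \<in> I"
    then obtain c where c: "c \<in> A" "(snd i, c) \<in> r" "(snd j, c) \<in> r"
      using dir[of "snd i" "snd j"] by (auto simp: I_def)
    then show "\<exists>k\<in>I. (i, k) \<in> s \<and> (j, k) \<in> s"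
      using ij by (intro bexI[of _ "(fst i \<inter> fst j, c)"]) (auto simp: I_def s_def)
  qed
  have "left_cauchy_net (G n) (T n) I s y"
    unfolding left_cauchy_net_def
  proof (intro conjI allI impI dirI)
    show "y ` I \<subseteq> carrier (G n)" using yn by auto
    fix N assume "identity_nbhd (G n) (T n) N"
    then obtain N' where N': "openin (T n) N'" "\<one>\<^bsub>G n\<^esub> \<in> N'" "N' \<subseteq> N" by (auto simp: identity_nbhd_def)
    \<comment> \<open>The estimate runs through values of x outside G_n, so the neighbourhood is
      first extended to the union.\<close>
    obtain W where W: "openin ?O W" "W \<inter> carrier (G n) = N'"
      using openin_O_DL_extension[OF seq N'(1)] .
    have "\<one>\<^bsub>?H\<^esub> = \<one>\<^bsub>G n\<^esub>"
      using hom_one[OF union_group_inclusion_hom[OF seq] _ H.is_group, of n] seq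
      by (auto simp: strict_direct_sequence_def topological_group_def)
    then have "\<one>\<^bsub>?H\<^esub> \<in> W" using N' W by auto
    from topological_group_mult_mult_inv_nbhd[OF tg W(1) this]
    obtain V where V: "openin ?O V" "\<one>\<^bsub>?H\<^esub> \<in> V"
      "\<And>u v w. u \<in> V \<Longrightarrow> v \<in> V \<Longrightarrow> w \<in> V \<Longrightarrow> u \<otimes>\<^bsub>?H\<^esub> v \<otimes>\<^bsub>?H\<^esub> inv\<^bsub>?H\<^esub> w \<in> W" by metis
    obtain c where c: "c \<in> A" "\<And>\<alpha> \<beta>. \<alpha> \<in> A \<Longrightarrow> \<beta> \<in> A \<Longrightarrow> (c, \<alpha>) \<in> r \<Longrightarrow> (c, \<beta>) \<in> r \<Longrightarrow>
        inv\<^bsub>?H\<^esub> (x \<beta>) \<otimes>\<^bsub>?H\<^esub> x \<alpha> \<in> V"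
      using cauchy[OF V(1,2)] by auto
    \<comment> \<open>Past this index V bounds the approximation errors, and c bounds the quotients
      of the values of x.\<close>
    have VcI: "(V, c) \<in> I" using V c by (simp add: I_def)
    show "\<exists>\<gamma>\<in>I. \<forall>\<alpha>\<in>I. \<forall>\<beta>\<in>I. (\<gamma>, \<alpha>) \<in> s \<longrightarrow> (\<gamma>, \<beta>) \<in> s \<longrightarrow> inv\<^bsub>G n\<^esub> (y \<beta>) \<otimes>\<^bsub>G n\<^esub> y \<alpha> \<in> N"
    proof (intro bexI[OF _ VcI] ballI impI)
      fix i j assume ij: "i \<in> I" "j \<in> I" "((V, c), i) \<in> s" "((V, c), j) \<in> s"
      have cb: "(c, b i) \<in> r" "(c, b j) \<in> r"
        using ij tr[OF _ br[OF ij(1)]] tr[OF _ br[OF ij(2)]] by (auto simp: s_def)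
      have cl: "x (b i) \<in> carrier ?H" "x (b j) \<in> carrier ?H" "y i \<in> carrier ?H" "y j \<in> carrier ?H"
        using xc bA yc ij by auto
      have "inv\<^bsub>?H\<^esub> (y i) \<otimes>\<^bsub>?H\<^esub> x (b i) \<in> V" "inv\<^bsub>?H\<^esub> (y j) \<otimes>\<^bsub>?H\<^esub> x (b j) \<in> V"
        using yx[OF ij(1)] yx[OF ij(2)] ij by (auto simp: s_def)
      \<comment> \<open>The path from \<open>y j\<close> to \<open>y i\<close> goes through
        \<open>x (b j)\<close> and \<open>x (b i)\<close>; its last leg is an inverted approximation
        error.\<close>
      then have "(inv\<^bsub>?H\<^esub> (y j) \<otimes>\<^bsub>?H\<^esub> x (b j)) \<otimes>\<^bsub>?H\<^esub> (inv\<^bsub>?H\<^esub> (x (b j)) \<otimes>\<^bsub>?H\<^esub> x (b i))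
          \<otimes>\<^bsub>?H\<^esub> inv\<^bsub>?H\<^esub> (inv\<^bsub>?H\<^esub> (y i) \<otimes>\<^bsub>?H\<^esub> x (b i)) \<in> W"
        using V(3) c(2)[OF bA[OF ij(1)] bA[OF ij(2)] cb] by blast
      also have "(inv\<^bsub>?H\<^esub> (y j) \<otimes>\<^bsub>?H\<^esub> x (b j)) \<otimes>\<^bsub>?H\<^esub> (inv\<^bsub>?H\<^esub> (x (b j)) \<otimes>\<^bsub>?H\<^esub> x (b i))
          \<otimes>\<^bsub>?H\<^esub> inv\<^bsub>?H\<^esub> (inv\<^bsub>?H\<^esub> (y i) \<otimes>\<^bsub>?H\<^esub> x (b i)) = inv\<^bsub>?H\<^esub> (y j) \<otimes>\<^bsub>?H\<^esub> y i"
      proof -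
        have "x (b j) \<otimes>\<^bsub>?H\<^esub> (inv\<^bsub>?H\<^esub> (x (b j)) \<otimes>\<^bsub>?H\<^esub> z) = z" if "z \<in> carrier ?H" for z
          using cl that by (simp flip: H.m_assoc)
        moreover have "x (b i) \<otimes>\<^bsub>?H\<^esub> (inv\<^bsub>?H\<^esub> (x (b i)) \<otimes>\<^bsub>?H\<^esub> y i) = y i"
          using cl by (simp flip: H.m_assoc)
        ultimately show ?thesis using cl by (simp add: H.inv_mult_group H.m_assoc)
      qed
      finally have "inv\<^bsub>G n\<^esub> (y j) \<otimes>\<^bsub>G n\<^esub> y i \<in> W"
        using strict_direct_sequence_inv_mult[OF seq yn[OF ij(2)] yn[OF ij(1)]] by simp
      moreover have "inv\<^bsub>G n\<^esub> (y j) \<otimes>\<^bsub>G n\<^esub> y i \<in> carrier (G n)"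
        using yn[OF ij(1)] yn[OF ij(2)] seq
        by (auto simp: strict_direct_sequence_def topological_group_def
            intro!: monoid.m_closed[OF group.is_monoid] group.inv_closed)
      ultimately show "inv\<^bsub>G n\<^esub> (y j) \<otimes>\<^bsub>G n\<^esub> y i \<in> N" using W N' by auto
    qed
  qed
  moreover have "topological_group (G n) (T n)" using seq by (simp add: strict_direct_sequence_def)
  \<comment> \<open>The indices are pairs, not subsets of the group, so completeness is applied in
    its form for arbitrary index types.\<close>
  ultimately obtain l where l: "net_converges_to (T n) I s y l"
    using complete_group_net_converges assms(2) by blast
  have ln: "l \<in> carrier (G n)"
    using l seq by (simp add: net_converges_to_def strict_direct_sequence_def topological_group_def)
  then have lc: "l \<in> carrier ?H" by (auto simp: carrier_union_group)
  have "net_converges_to ?O A r x l"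
    unfolding net_converges_to_def
  proof (intro conjI allI impI)
    show "l \<in> topspace ?O" using lc tO by simp
    fix U assume U: "openin ?O U" "l \<in> U"
    \<comment> \<open>\<open>x \<alpha>\<close> will be written as \<open>y j\<close> in P, times an
      approximation error in R, times a Cauchy quotient in S, where R S lies in Q and P Q in
      U.\<close>
    obtain P Q where PQ: "openin ?O P" "openin ?O Q" "l \<in> P" "\<one>\<^bsub>?H\<^esub> \<in> Q"
      "\<And>u v. u \<in> P \<Longrightarrow> v \<in> Q \<Longrightarrow> u \<otimes>\<^bsub>?H\<^esub> v \<in> U"
      using topological_group_prod_nbhd[OF tg U(1) lc H.one_closed] U lc by auto
    obtain R S where RS: "openin ?O R" "openin ?O S" "\<one>\<^bsub>?H\<^esub> \<in> R" "\<one>\<^bsub>?H\<^esub> \<in> S"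
      "\<And>u v. u \<in> R \<Longrightarrow> v \<in> S \<Longrightarrow> u \<otimes>\<^bsub>?H\<^esub> v \<in> Q"
      using topological_group_prod_nbhd[OF tg PQ(2) H.one_closed H.one_closed] PQ by auto
    obtain c where c: "c \<in> A" "\<And>\<alpha> \<beta>. \<alpha> \<in> A \<Longrightarrow> \<beta> \<in> A \<Longrightarrow> (c, \<alpha>) \<in> r \<Longrightarrow> (c, \<beta>) \<in> r \<Longrightarrow>
        inv\<^bsub>?H\<^esub> (x \<beta>) \<otimes>\<^bsub>?H\<^esub> x \<alpha> \<in> S"
      using cauchy[OF RS(2,4)] by auto
    have "openin (T n) (P \<inter> carrier (G n))" using PQ(1) by (simp add: openin_O_DL)
    then have "\<exists>i\<in>I. \<forall>j\<in>I. (i, j) \<in> s \<longrightarrow> y j \<in> P \<inter> carrier (G n)"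
      using l IntI[OF PQ(3) ln] unfolding net_converges_to_def by iprover
    then obtain i where i: "i \<in> I" "\<And>j. j \<in> I \<Longrightarrow> (i, j) \<in> s \<Longrightarrow> y j \<in> P" by auto
    have "(R, c) \<in> I" using RS c by (simp add: I_def)
    \<comment> \<open>A single j suffices: the Cauchy condition carries closeness at
      \<open>b j\<close> to every \<alpha> past c.\<close>
    then obtain j where j: "j \<in> I" "(i, j) \<in> s" "((R, c), j) \<in> s"
      using dirI i(1) unfolding directed_set_def by meson
    have cb: "(c, b j) \<in> r" using j tr[OF _ br[OF j(1)]] by (auto simp: s_def)
    show "\<exists>\<gamma>\<in>A. \<forall>\<alpha>\<in>A. (\<gamma>, \<alpha>) \<in> r \<longrightarrow> x \<alpha> \<in> U"
    proof (intro bexI[OF _ c(1)] ballI impI)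
      fix \<alpha> assume \<alpha>: "\<alpha> \<in> A" "(c, \<alpha>) \<in> r"
      have "inv\<^bsub>?H\<^esub> (y j) \<otimes>\<^bsub>?H\<^esub> x (b j) \<in> R" using yx[OF j(1)] j by (auto simp: s_def)
      moreover have "inv\<^bsub>?H\<^esub> (x (b j)) \<otimes>\<^bsub>?H\<^esub> x \<alpha> \<in> S" using c(2)[OF \<alpha>(1) bA[OF j(1)] \<alpha>(2) cb] .
      ultimately have "y j \<otimes>\<^bsub>?H\<^esub> ((inv\<^bsub>?H\<^esub> (y j) \<otimes>\<^bsub>?H\<^esub> x (b j)) \<otimes>\<^bsub>?H\<^esub> (inv\<^bsub>?H\<^esub> (x (b j)) \<otimes>\<^bsub>?H\<^esub> x \<alpha>)) \<in> U"
        using i(2)[OF j(1,2)] PQ(5) RS(5) by blast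
      moreover have "y j \<otimes>\<^bsub>?H\<^esub> (inv\<^bsub>?H\<^esub> (y j) \<otimes>\<^bsub>?H\<^esub> z) = z"
        "x (b j) \<otimes>\<^bsub>?H\<^esub> (inv\<^bsub>?H\<^esub> (x (b j)) \<otimes>\<^bsub>?H\<^esub> z) = z" if "z \<in> carrier ?H" for z
        using that yc[OF j(1)] xc[OF bA[OF j(1)]] by (simp_all flip: H.m_assoc)
      ultimately show "x \<alpha> \<in> U"
        using yc[OF j(1)] xc[OF bA[OF j(1)]] xc[OF \<alpha>(1)] by (simp add: H.m_assoc)
    qed
  qed
  then show "\<exists>l. net_converges_to (O_TG G T) A r x l" using assms(3) by auto
qed

end
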